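(* Let $h=(h(n))_{n\ge1}$ be a bounded sequence of positive real numbers with $h(1)=1$, and for $n\ge2$ let $\rho_n^h$ be the spectral radius of the matrix $M_n^h$. Then the increasing sequence $(\rho_n^h)_{n\ge2}$ has a finite limit. More precisely, \[ 0<\rho_2^h<\rho_3^h<\cdots,\qquad \lim_{n\to\infty}\rho_n^h\le 9.7225\,\sup_{m\ge1}h(m). \]
   Context: Let $\sigma(k)=\sum_{d\mid k}d$. The sequence $(c_n)_{n\ge0}$ is defined by $c_0:=1$ and $c_n:=\sum_{k=0}^{n-1}(-1)^{n-k+1}\sigma(n-k+1)\,c_k$ for $n\ge1$. For $n\ge2$, $M_n^h$ is the $(n-1)\times(n-1)$ matrix with entries, for $1\le i,j\le n-1$, \[ (M_n^h)_{ij}=\begin{cases} c_{i-j+1}\,h(j), & i\ge j-1,\\ 0, & j>i+1.\end{cases} \] *)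

theory Defs
  imports Complex_Main "Jordan_Normal_Form.Spectral_Radius" "HOL-Analysis.Elementary_Metric_Spaces"
begin

definition divisor_sum :: "nat \<Rightarrow> nat" where
  "divisor_sum k = (\<Sum>d | d dvd k. d)"

fun c_seq :: "nat \<Rightarrow> int" where
  "c_seq n = (if n = 0 then 1
          else (\<Sum>k = 0..n - 1. (- 1) ^ (n - k + 1) * int (divisor_sum (n - k + 1)) * c_seq k))"

declare c_seq.simps [simp del]

(* The AFP matrices are indexed from 0, so position (i, j) holds the entry of row i + 1 and
   column j + 1.  The entries are real; they are embedded into the complex numbers because
   spectral_radius is defined for complex matrices. *)
definition M_mat :: "(nat \<Rightarrow> real) \<Rightarrow> nat \<Rightarrow> complex mat" where
  "M_mat h n = mat (n - 1) (n - 1) (\<lambda>(i, j).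
     let i' = i + 1; j' = j + 1
     in if j' \<le> i' + 1 then complex_of_real (of_int (c_seq (i' + 1 - j')) * h j') else 0)"

definition rho :: "(nat \<Rightarrow> real) \<Rightarrow> nat \<Rightarrow> real" where
  "rho h n = spectral_radius (M_mat h n)"

end

theory Submission
  imports Defs "HOL-Computational_Algebra.Formal_Power_Series"
begin

text \<open>For a lower Hessenberg matrix with positive entries on and below the superdiagonal, solving
  \<open>A v = l v\<close> row by row from \<open>v\<^sub>0 = 1\<close> determines \<open>v\<close>, and \<open>l\<close> is an eigenvalue of the \<open>n \<times> n\<close>
  truncation iff \<open>v\<^sub>n(l) = 0\<close>. The largest zeros of these functions increase strictly with \<open>n\<close>, and at
  the largest zero \<open>v\<close> is a positive eigenvector, so this zero is the spectral radius.

  Positivity of \<open>c\<^sub>n\<close>: with \<open>S(x) = \<Sum> (-1)\<^sup>m \<sigma>(m+1) x\<^sup>m\<close> the generating function of \<open>c\<close> is \<open>1 / S\<close>, and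
  multiplying \<open>S\<close> by \<open>1 - 3x\<^sup>2 - 2x\<^sup>3\<close> yields \<open>1 - 3x\<close> up to small coefficients.

  The upper bound comes from the weights \<open>x\<^sup>i\<close>: each weighted column sum is at most \<open>sup h / (x S(x))\<close>
  times the weight of the column. The value \<open>x = 11/50\<close> is close to the minimiser of \<open>1 / (x S(x))\<close>.\<close>

section \<open>Spectral radii of positive Hessenberg matrices\<close>

locale pos_hessenberg =
  fixes A :: "nat \<Rightarrow> nat \<Rightarrow> real"
  assumes entry_pos: "j \<le> Suc i \<Longrightarrow> 0 < A i j"
    and upper_zero: "Suc i < j \<Longrightarrow> A i j = 0"
begin

lemma super_pos: "0 < A i (Suc i)"
  by (simp add: entry_pos)

lemma entry_nonneg: "0 \<le> A i j"
  using entry_pos[of j i] upper_zero[of i j] by (cases "j \<le> Suc i") auto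

fun eigvec :: "real \<Rightarrow> nat \<Rightarrow> real" where
  "eigvec l 0 = 1"
| "eigvec l (Suc n) = (l * eigvec l n - (\<Sum>j\<le>n. A n j * eigvec l j)) / A n (Suc n)"

declare eigvec.simps(2) [simp del]

lemma row_eq: "(\<Sum>j\<le>Suc i. A i j * eigvec l j) = l * eigvec l i"
  using super_pos[of i] by (simp add: eigvec.simps(2))

text \<open>For \<open>i < m\<close> the nonzero part of row \<open>i\<close> leaves the truncation
  at most through column \<open>m\<close>, where \<open>eigvec l m = 0\<close>.\<close>

lemma row_eq_truncated:
  assumes "eigvec l m = 0" "i < m"
  shows "(\<Sum>j<m. A i j * eigvec l j) = l * eigvec l i"
proof -
  have "(\<Sum>j\<le>m. A i j * eigvec l j) = (\<Sum>j\<le>Suc i. A i j * eigvec l j)"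
    by (rule sum.mono_neutral_right) (use assms upper_zero in auto)
  moreover have "(\<Sum>j\<le>m. A i j * eigvec l j) = (\<Sum>j<m. A i j * eigvec l j)"
    using assms by (simp add: lessThan_Suc_atMost[symmetric])
  ultimately show ?thesis by (simp only: row_eq)
qed

lemma continuous_eigvec: "continuous_on UNIV (\<lambda>l. eigvec l n)"
proof (induction n rule: less_induct)
  case (less n)
  show ?case
  proof (cases n)
    case (Suc k)
    have "continuous_on UNIV (\<lambda>l. eigvec l j)" if "j \<le> k" for j
      using less that Suc by simp
    then show ?thesis
      unfolding Suc eigvec.simps using super_pos[of k]
      by (intro continuous_intros) auto
  qed simp
qed

text \<open>Carrying along that the newest component is the largest bounds the subtracted sum by a
  row sum times \<open>eigvec l n\<close>; any \<open>l\<close> above the full row sum then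
  works.\<close>

lemma eigvec_dominant_at_top:
  "eventually (\<lambda>l. 0 < eigvec l n \<and> (\<forall>j\<le>n. 0 \<le> eigvec l j \<and> eigvec l j \<le> eigvec l n)) at_top"
proof (induction n)
  case (Suc n)
  have "eventually (\<lambda>l. (\<Sum>j\<le>n. A n j) + A n (Suc n) \<le> l) at_top"
    by (rule eventually_ge_at_top)
  with Suc show ?case
  proof eventually_elim
    case (elim l)
    have "(\<Sum>j\<le>n. A n j * eigvec l j) \<le> (\<Sum>j\<le>n. A n j) * eigvec l n"
      unfolding sum_distrib_right
      by (intro sum_mono mult_left_mono) (use elim entry_nonneg in auto)
    moreover have "((\<Sum>j\<le>n. A n j) + A n (Suc n)) * eigvec l n \<le> l * eigvec l n"
      by (intro mult_right_mono) (use elim in auto)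
    ultimately have "eigvec l n * A n (Suc n) \<le> l * eigvec l n - (\<Sum>j\<le>n. A n j * eigvec l j)"
      by (simp add: algebra_simps)
    then have "eigvec l n \<le> eigvec l (Suc n)"
      using super_pos[of n] by (simp add: eigvec.simps(2) pos_le_divide_eq)
    with elim show ?case
      by (auto simp: le_Suc_eq intro: order_trans)
  qed
qed simp

text \<open>\<open>r\<close> is the largest zero of \<open>eigvec _ n\<close>. Positivity at
  \<open>r\<close> makes the eigenvector positive; positivity to the right confines the next
  zero.\<close>

definition perron :: "nat \<Rightarrow> real \<Rightarrow> bool" where
  "perron n r \<longleftrightarrow> eigvec r n = 0 \<and> (\<forall>k<n. 0 < eigvec r k) \<and> (\<forall>l>r. \<forall>k\<le>n. 0 < eigvec l k)"

lemma perron_1: "perron 1 (A 0 0)"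
  using super_pos[of 0] by (auto simp: perron_def eigvec.simps(2) le_Suc_eq)

text \<open>At a Perron root \<open>r\<close> of order \<open>n\<close> the recursion makes \<open>eigvec r (Suc n)\<close> negative, whereas
  \<open>eigvec l (Suc n)\<close> is positive for large \<open>l\<close>, so the next zero lies strictly to the right of \<open>r\<close>.\<close>

lemma perron_Suc:
  assumes "perron n r" "n \<ge> 1"
  shows "\<exists>r'>r. perron (Suc n) r'"
proof -
  have pos: "0 < eigvec r k" if "k < n" for k using assms that by (simp add: perron_def)
  have zero: "eigvec r n = 0" using assms by (simp add: perron_def)
  have right: "0 < eigvec l k" if "l > r" "k \<le> n" for l k using assms that by (simp add: perron_def)
  obtain m where n: "n = Suc m" using assms(2) by (cases n) auto
  have neg: "eigvec r (Suc n) < 0"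
  proof -
    have "0 < (\<Sum>j\<le>n. A n j * eigvec r j)"
    proof (rule sum_pos2)
      show "0 < A n m * eigvec r m" using entry_pos[of m n] pos[of m] n by simp
      show "0 \<le> A n j * eigvec r j" if "j \<in> {..n}" for j
        using that pos[of j] zero entry_nonneg[of n j] by (cases "j = n") auto
    qed (use n in auto)
    then show ?thesis using super_pos[of n] zero by (simp add: eigvec.simps(2) divide_less_0_iff)
  qed
  obtain B where B: "\<And>l. l \<ge> B \<Longrightarrow> 0 < eigvec l (Suc n)"
    using eigvec_dominant_at_top[of "Suc n"] by (auto simp: eventually_at_top_linorder)
  \<comment> \<open>Compactness provides a last point where the function is nonpositive; it is the
    largest zero.\<close>
  define Z where "Z = {r..B} \<inter> {l. eigvec l (Suc n) \<le> 0}"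
  have "closed {l. eigvec l (Suc n) \<le> 0}"
    by (intro closed_Collect_le continuous_eigvec continuous_intros)
  then have "compact Z" unfolding Z_def by (intro compact_Int_closed) auto
  moreover have "r \<in> Z" using neg B[of r] unfolding Z_def by force
  ultimately obtain r' where r': "r' \<in> Z" "\<And>l. l \<in> Z \<Longrightarrow> l \<le> r'"
    using compact_attains_sup[of Z] by auto
  have gt: "0 < eigvec l (Suc n)" if "l > r'" for l
    using r'(2)[of l] r'(1) that B[of l] unfolding Z_def by fastforce
  have "eigvec r' (Suc n) = 0"
  proof (rule ccontr)
    assume "eigvec r' (Suc n) \<noteq> 0"
    then have lt: "eigvec r' (Suc n) < 0" using r'(1) by (simp add: Z_def)
    have "\<exists>x\<ge>r'. x \<le> r' + 1 \<and> eigvec x (Suc n) = 0"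
      by (rule IVT') (use lt gt[of "r' + 1"] continuous_on_subset[OF continuous_eigvec] in auto)
    then obtain x where "x \<ge> r'" "eigvec x (Suc n) = 0" by auto
    then show False using gt[of x] lt by (cases "x = r'") auto
  qed
  moreover have "r < r'" using r'(1) neg calculation unfolding Z_def by (cases "r = r'") auto
  ultimately show ?thesis
    using right gt by (auto simp: perron_def le_Suc_eq intro!: exI[of _ r'])
qed

lemma perron_unique: "perron n r \<Longrightarrow> perron n r' \<Longrightarrow> r = r'"
  by (metis less_irrefl linorder_neqE order_refl perron_def)

section \<open>Perron roots as spectral radii, and their upper bound\<close>

definition trunc :: "nat \<Rightarrow> complex mat" where
  "trunc m = mat m m (\<lambda>(i, j). complex_of_real (A i j))"

text \<open>Any other eigenvector is compared with the positive one: the row where the quotient of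
  moduli is maximal bounds its eigenvalue by \<open>r\<close>.\<close>

lemma spectral_radius_trunc:
  assumes "perron m r" "m \<ge> 1" "0 \<le> r"
  shows "spectral_radius (trunc m) = r"
proof -
  have M: "trunc m \<in> carrier_mat m m" by (simp add: trunc_def)
  have pos: "0 < eigvec r k" if "k < m" for k using assms that by (simp add: perron_def)
  have zero: "eigvec r m = 0" using assms by (simp add: perron_def)
  have mult: "(trunc m *\<^sub>v w) $ i = (\<Sum>j<m. complex_of_real (A i j) * w $ j)"
    if "i < m" "w \<in> carrier_vec m" for w i
    using that by (auto simp: trunc_def scalar_prod_def atLeast0LessThan intro!: sum.cong)
  let ?w = "vec m (\<lambda>i. complex_of_real (eigvec r i))"
  have "eigenvector (trunc m) ?w (of_real r)"
    unfolding eigenvector_def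
  proof (intro conjI)
    show "?w \<in> carrier_vec (dim_row (trunc m))" by (simp add: trunc_def)
    show "?w \<noteq> 0\<^sub>v (dim_row (trunc m))"
    proof
      assume "?w = 0\<^sub>v (dim_row (trunc m))"
      then have "?w $ 0 = 0\<^sub>v m $ 0" by (simp add: trunc_def)
      then show False using assms(2) by simp
    qed
    show "trunc m *\<^sub>v ?w = complex_of_real r \<cdot>\<^sub>v ?w"
    proof (rule eq_vecI)
      fix i assume "i < dim_vec (complex_of_real r \<cdot>\<^sub>v ?w)"
      then have i: "i < m" by simp
      have "(trunc m *\<^sub>v ?w) $ i = of_real (\<Sum>j<m. A i j * eigvec r j)"
        by (subst mult) (use i in auto)
      then show "(trunc m *\<^sub>v ?w) $ i = (complex_of_real r \<cdot>\<^sub>v ?w) $ i"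
        using i by (simp add: row_eq_truncated[OF zero i])
    qed (simp add: trunc_def)
  qed
  then have mem: "complex_of_real r \<in> spectrum (trunc m)"
    by (auto simp: spectrum_def eigenvalue_def)
  have bound: "norm z \<le> r" if z: "z \<in> spectrum (trunc m)" for z
  proof -
    obtain w where "eigenvector (trunc m) w z"
      using z by (auto simp: spectrum_def eigenvalue_def)
    then have w: "w \<in> carrier_vec m" "w \<noteq> 0\<^sub>v m" and eq: "trunc m *\<^sub>v w = z \<cdot>\<^sub>v w"
      by (auto simp: eigenvector_def trunc_def)
    define q where "q i = norm (w $ i) / eigvec r i" for i
    have "finite (q ` {..<m})" "q ` {..<m} \<noteq> {}"
      using assms(2) by (auto simp: lessThan_empty_iff)
    from Max_in[OF this] obtain i where i: "i < m" "q i = Max (q ` {..<m})" by auto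
    have le: "q j \<le> q i" if "j < m" for j unfolding i(2) using that by auto
    have "\<exists>j<m. w $ j \<noteq> 0" using w by (metis carrier_vecD eq_vecI index_zero_vec)
    then obtain j0 where "j0 < m" "w $ j0 \<noteq> 0" by auto
    then have "0 < q j0" using pos by (simp add: q_def)
    then have qpos: "0 < q i" using le[OF \<open>j0 < m\<close>] by simp
    have nw: "norm (w $ j) = q j * eigvec r j" if "j < m" for j
      using pos[OF that] by (simp add: q_def)
    have "norm z * norm (w $ i) = norm ((trunc m *\<^sub>v w) $ i)"
      using eq i(1) w(1) by (simp add: norm_mult)
    also have "\<dots> = norm (\<Sum>j<m. complex_of_real (A i j) * w $ j)"
      using mult[OF i(1) w(1)] by simp
    also have "\<dots> \<le> (\<Sum>j<m. A i j * norm (w $ j))"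
      by (rule order_trans[OF norm_sum]) (simp add: norm_mult entry_nonneg)
    also have "\<dots> \<le> (\<Sum>j<m. A i j * (q i * eigvec r j))"
      by (intro sum_mono mult_left_mono entry_nonneg)
        (use le pos nw in \<open>auto intro!: mult_right_mono simp: less_imp_le\<close>)
    also have "\<dots> = q i * (\<Sum>j<m. A i j * eigvec r j)"
      by (simp add: sum_distrib_left algebra_simps)
    also have "\<dots> = r * norm (w $ i)"
      using i(1) by (simp add: row_eq_truncated[OF zero i(1)] nw)
    finally show ?thesis
      using qpos pos[OF i(1)] nw[OF i(1)] by (simp add: mult_le_cancel_right)
  qed
  show ?thesis
    unfolding spectral_radius_def
  proof (rule Max_eqI)
    show "finite (norm ` spectrum (trunc m))" using card_finite_spectrum(1)[OF M] by simp
    show "r \<in> norm ` spectrum (trunc m)" using mem assms(3) by (force simp: image_iff)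
  qed (use bound in auto)
qed

text \<open>Pairing the positive eigenvector \<open>v\<close> with the weights and swapping sums
  gives \<open>r * T \<le> K * T\<close>, where \<open>T\<close> is the pairing of \<open>u\<close>
  and \<open>v\<close>.\<close>

lemma perron_le:
  assumes "perron m r" "m \<ge> 1"
    and u: "\<And>i. 0 < u i"
    and le: "\<And>j. (\<Sum>i<m. u i * A i j) \<le> K * u j"
  shows "r \<le> K"
proof -
  have pos: "0 < eigvec r k" if "k < m" for k using assms that by (simp add: perron_def)
  have zero: "eigvec r m = 0" using assms by (simp add: perron_def)
  define T where "T = (\<Sum>i<m. u i * eigvec r i)"
  have "0 < T" unfolding T_def
    by (rule sum_pos) (use u pos assms(2) in \<open>auto simp: lessThan_empty_iff\<close>)
  have "r * T = (\<Sum>i<m. u i * (r * eigvec r i))"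
    by (simp add: T_def sum_distrib_left algebra_simps)
  also have "\<dots> = (\<Sum>i<m. u i * (\<Sum>j<m. A i j * eigvec r j))"
    by (intro sum.cong) (auto simp: row_eq_truncated[OF zero])
  also have "\<dots> = (\<Sum>i<m. \<Sum>j<m. u i * A i j * eigvec r j)"
    by (simp add: sum_distrib_left algebra_simps)
  also have "\<dots> = (\<Sum>j<m. (\<Sum>i<m. u i * A i j) * eigvec r j)"
    by (subst sum.swap) (simp add: sum_distrib_right)
  also have "\<dots> \<le> (\<Sum>j<m. K * u j * eigvec r j)"
    by (intro sum_mono mult_right_mono le) (use pos in \<open>auto simp: less_imp_le\<close>)
  also have "\<dots> = K * T" by (simp add: T_def sum_distrib_left algebra_simps)
  finally show ?thesis using \<open>0 < T\<close> by simp
qed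

lemma perron_chain: "\<exists>f. (\<forall>n. perron (Suc n) (f n)) \<and> strict_mono f \<and> f 0 = A 0 0"
proof -
  have "\<exists>f. \<forall>n. perron (Suc n) (f n) \<and> f n < f (Suc n)"
    by (rule dependent_nat_choice) (use perron_1 perron_Suc in \<open>auto simp: Bex_def\<close>)
  then obtain f where f: "\<And>n. perron (Suc n) (f n)" "\<And>n. f n < f (Suc n)" by blast
  \<comment> \<open>Dependent choice leaves the starting value open; uniqueness fixes it.\<close>
  have "f 0 = A 0 0" using perron_unique[OF f(1)[of 0]] perron_1 by simp
  with f show ?thesis by (auto simp: strict_mono_Suc_iff)
qed

end

section \<open>Positivity and growth of \<open>c_seq\<close>\<close>

text \<open>A form in which simplification can evaluate divisor sums of numerals.\<close>

lemma divisor_sum_eq_sum_list: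
  assumes "k \<ge> 2"
  shows "divisor_sum k = Suc (sum_list (filter (\<lambda>d. d dvd k) [2..<k + 1]))"
proof -
  have "{d. d dvd k} = insert 1 {d \<in> {2..<k + 1}. d dvd k}"
  proof (intro equalityI subsetI)
    fix d assume "d \<in> {d. d dvd k}"
    then have d: "d dvd k" "d \<noteq> 0" "d \<le> k"
      using assms dvd_pos_nat[of k d] dvd_imp_le[of d k] by auto
    then show "d \<in> insert 1 {d \<in> {2..<k + 1}. d dvd k}"
      by (cases "d = 1") auto
  qed auto
  then have *: "{d. d dvd k} = insert 1 (set (filter (\<lambda>d. d dvd k) [2..<k + 1]))"
    by (simp only: set_filter set_upt)
  have "sum_list (filter (\<lambda>d. d dvd k) [2..<k + 1]) = \<Sum>(set (filter (\<lambda>d. d dvd k) [2..<k + 1]))"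
    by (metis distinct_filter distinct_upt list.map_ident sum.distinct_set_conv_list)
  moreover have "1 \<notin> set (filter (\<lambda>d. d dvd k) [2..<k + 1])" by simp
  ultimately show ?thesis unfolding divisor_sum_def *
    by (subst sum.insert) auto
qed

lemma divisor_sum_le: "2 * divisor_sum k \<le> k * (k + 1)"
proof (cases "k = 0")
  case False
  have "divisor_sum k \<le> \<Sum>{0..k}" unfolding divisor_sum_def
    by (rule sum_mono2) (use False in \<open>auto dest: dvd_imp_le\<close>)
  then show ?thesis using gauss_sum_nat[of k] by simp
qed (simp add: divisor_sum_def)

definition alt_sigma :: "nat \<Rightarrow> int" where
  "alt_sigma m = (- 1) ^ m * int (divisor_sum (Suc m))"

lemma alt_sigma_values:
  "alt_sigma 0 = 1" "alt_sigma 1 = - 3" "alt_sigma 2 = 4" "alt_sigma 3 = - 7"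
  "alt_sigma 4 = 6" "alt_sigma 5 = - 12" "alt_sigma 6 = 8" "alt_sigma 7 = - 15"
  "alt_sigma 8 = 13" "alt_sigma 9 = - 18" "alt_sigma 10 = 12" "alt_sigma 11 = - 28"
  "alt_sigma 12 = 14" "alt_sigma 13 = - 24" "alt_sigma 14 = 24"
  "alt_sigma 15 = - 31"
  by (simp_all add: alt_sigma_def divisor_sum_eq_sum_list) (simp add: divisor_sum_def)

lemma alt_sigma_bound: "\<bar>real_of_int (alt_sigma m)\<bar> \<le> (real m + 1) * (real m + 2) / 2"
proof -
  have "real (2 * divisor_sum (Suc m)) \<le> real (Suc m * (Suc m + 1))"
    using divisor_sum_le[of "Suc m"] of_nat_le_iff by blast
  then show ?thesis by (simp add: alt_sigma_def abs_mult algebra_simps)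
qed

lemma c_seq_0: "c_seq 0 = 1"
  by (simp add: c_seq.simps)

text \<open>The defining recurrence with all terms on one side: the factor of \<open>c_seq k\<close>
  in it is \<open>- alt_sigma (n - k)\<close>, and \<open>alt_sigma 0 = 1\<close> accounts for
  \<open>c_seq n\<close>.\<close>

lemma c_seq_mult_alt_sigma: "Abs_fps c_seq * Abs_fps alt_sigma = 1"
proof (rule fps_ext)
  fix n
  show "fps_nth (Abs_fps c_seq * Abs_fps alt_sigma) n = fps_nth 1 n"
  proof (cases n)
    case 0
    then show ?thesis using alt_sigma_values(1) by (simp add: c_seq_0)
  next
    case (Suc k)
    have "(\<Sum>i = 0..n. c_seq i * alt_sigma (n - i)) = c_seq n + (\<Sum>i = 0..k. c_seq i * alt_sigma (n - i))"
      using alt_sigma_values(1) by (simp add: Suc)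
    also have "c_seq n = (\<Sum>i = 0..k. - (c_seq i * alt_sigma (n - i)))"
      by (subst c_seq.simps) (auto simp: Suc alt_sigma_def intro!: sum.cong)
    finally show ?thesis by (simp add: fps_mult_nth Suc sum_negf)
  qed
qed

text \<open>The factor \<open>1 - 3 x\<^sup>2 - 2 x\<^sup>3\<close> was found by search: the resulting recurrence for \<open>c_seq\<close> is
  \<open>c\<^sub>n = 3 c\<^sub>n\<^sub>-\<^sub>1\<close> plus terms so small that positivity follows by induction.\<close>

definition damped_coeff :: "nat \<Rightarrow> int" where
  "damped_coeff m = alt_sigma m - 3 * (if m < 2 then 0 else alt_sigma (m - 2))
    - 2 * (if m < 3 then 0 else alt_sigma (m - 3))"

lemma fps_damped_coeff: "Abs_fps damped_coeff = Abs_fps alt_sigma * (1 - 3 * fps_X ^ 2 - 2 * fps_X ^ 3)"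
proof (rule fps_ext)
  fix n
  have "(Abs_fps alt_sigma * (1 - 3 * fps_X ^ 2 - 2 * fps_X ^ 3)) =
    Abs_fps alt_sigma - fps_const 3 * (fps_X ^ 2 * Abs_fps alt_sigma) - fps_const 2 * (fps_X ^ 3 * Abs_fps alt_sigma)"
    by (simp add: algebra_simps numeral_fps_const)
  then show "fps_nth (Abs_fps damped_coeff) n = fps_nth (Abs_fps alt_sigma * (1 - 3 * fps_X ^ 2 - 2 * fps_X ^ 3)) n"
    by (simp add: damped_coeff_def fps_X_power_mult_nth)
qed

lemma damped_coeff_values:
  "damped_coeff 0 = 1" "damped_coeff 1 = - 3" "damped_coeff 2 = 1" "damped_coeff 3 = 0"
  "damped_coeff 4 = 0" "damped_coeff 5 = 1" "damped_coeff 6 = 4" "damped_coeff 7 = 9"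
  "damped_coeff 8 = 13"
  by (simp_all add: damped_coeff_def alt_sigma_values[simplified])

text \<open>The damped series times that of \<open>c_seq\<close> is the cubic factor itself, whose
  coefficients vanish from degree 4 on.\<close>

lemma damped_recurrence:
  assumes "n \<ge> 4"
  shows "c_seq n = 3 * c_seq (n - 1) - (\<Sum>m = 2..n. damped_coeff m * c_seq (n - m))"
proof -
  have "Abs_fps damped_coeff * Abs_fps c_seq = (Abs_fps c_seq * Abs_fps alt_sigma) * (1 - 3 * fps_X ^ 2 - 2 * fps_X ^ 3)"
    by (simp add: fps_damped_coeff mult_ac)
  also have "\<dots> = 1 - fps_const 3 * fps_X ^ 2 - fps_const 2 * fps_X ^ 3"
    by (simp add: c_seq_mult_alt_sigma numeral_fps_const)
  finally have "fps_nth (Abs_fps damped_coeff * Abs_fps c_seq) n = 0"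
    using assms by (simp add: fps_X_power_nth)
  then have "(\<Sum>m = 0..n. damped_coeff m * c_seq (n - m)) = 0" by (simp add: fps_mult_nth)
  moreover have "{0..n} = insert 0 (insert 1 {2..n})" using assms by auto
  ultimately show ?thesis by (simp add: damped_coeff_values[simplified])
qed

text \<open>The multipliers 1, 3, 2 add up to 6, against the bound
  \<open>(m + 1) * (m + 2) / 2\<close> at the largest index.\<close>

lemma damped_coeff_bound:
  assumes "m \<ge> 3"
  shows "\<bar>real_of_int (damped_coeff m)\<bar> \<le> 3 * (real m + 1) * (real m + 2)"
proof -
  obtain k where m: "m = 3 + k" using assms le_Suc_ex by blast
  have "\<bar>real_of_int (damped_coeff m)\<bar> \<le> \<bar>real_of_int (alt_sigma m)\<bar> + 3 * \<bar>real_of_int (alt_sigma (m - 2))\<bar>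
      + 2 * \<bar>real_of_int (alt_sigma (m - 3))\<bar>"
    using assms by (simp add: damped_coeff_def)
  also have "\<dots> \<le> 3 * (real m + 1) * (real m + 2)"
    using alt_sigma_bound[of m] alt_sigma_bound[of "m - 2"] alt_sigma_bound[of "m - 3"]
    by (simp add: m algebra_simps)
  finally show ?thesis .
qed

text \<open>The second summand dominates the tail of the series, so that the bound can be proved by
  induction from a finite computation.\<close>

lemma sum_abs_damped_coeff_add_tail_le:
  assumes "n \<ge> 15"
  shows "(\<Sum>m = 2..n. \<bar>real_of_int (damped_coeff m)\<bar> * (4/9) ^ (m - 1)) + 12 * (n + 2) * (n + 3) * (4/9) ^ n \<le> 3/4"
  using assms
proof (induction n rule: dec_induct)
  case base
  have "{2..15::nat} = set [2..<16]" by (simp only: set_upt) auto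
  then have set: "{2..15::nat} = {2,3,4,5,6,7,8,9,10,11,12,13,14,15}"
    by (simp only: upt_rec_numeral) simp
  show ?case
    by (simp add: set damped_coeff_def alt_sigma_values[simplified] power_divide)
next
  case (step n)
  have "\<bar>real_of_int (damped_coeff (Suc n))\<bar> \<le> 3 * (real n + 2) * (real n + 3)"
    using damped_coeff_bound[of "Suc n"] step.hyps by (simp add: add_ac)
  \<comment> \<open>The old tail term pays for the next coefficient and the new tail term; to
    leading order this is \<open>3 + 12 * 4/9 < 12\<close>.\<close>
  moreover have "3 * (real n + 2) * (real n + 3) + 12 * (real n + 3) * (real n + 4) * (4/9)
      \<le> 12 * (real n + 2) * (real n + 3)"
  proof -
    have "15 \<le> real n" using step.hyps by simp
    then have "(3 * (real n + 2) + 12 * (real n + 4) * (4/9)) * (real n + 3) \<le> 12 * (real n + 2) * (real n + 3)"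
      by (intro mult_right_mono) auto
    then show ?thesis by (simp only: distrib_right distrib_left mult_ac)
  qed
  ultimately have "(\<bar>real_of_int (damped_coeff (Suc n))\<bar> + 12 * (real n + 3) * (real n + 4) * (4/9)) * (4/9) ^ n
      \<le> (12 * (real n + 2) * (real n + 3)) * (4/9) ^ n"
    by (intro mult_right_mono) auto
  then have "\<bar>real_of_int (damped_coeff (Suc n))\<bar> * (4/9) ^ n + 12 * (real n + 3) * (real n + 4) * (4/9) ^ Suc n
      \<le> 12 * (real n + 2) * (real n + 3) * (4/9) ^ n"
    by (simp only: distrib_right power_Suc mult.assoc)
  moreover have "(\<Sum>m = 2..Suc n. \<bar>real_of_int (damped_coeff m)\<bar> * (4/9) ^ (m - 1)) =
      (\<Sum>m = 2..n. \<bar>real_of_int (damped_coeff m)\<bar> * (4/9) ^ (m - 1)) + \<bar>real_of_int (damped_coeff (Suc n))\<bar> * (4/9) ^ n"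
    using step.hyps by (subst sum.cl_ivl_Suc) simp
  moreover have "real (Suc n) + 2 = real n + 3" "real (Suc n) + 3 = real n + 4" by simp_all
  ultimately show ?case using step.IH by (simp only: of_nat_add of_nat_numeral)
qed

text \<open>The constants are self-consistent: growth by at least 9/4 discounts earlier terms by
  powers of 4/9, and the resulting error 3/4 leaves a growth of at least
  \<open>3 - 3/4 = 9/4\<close>.\<close>

lemma sum_abs_damped_coeff_le: "(\<Sum>m = 2..n. \<bar>real_of_int (damped_coeff m)\<bar> * (4/9) ^ (m - 1)) \<le> 3/4"
proof -
  have "(\<Sum>m = 2..n. \<bar>real_of_int (damped_coeff m)\<bar> * (4/9) ^ (m - 1))
      \<le> (\<Sum>m = 2..n + 15. \<bar>real_of_int (damped_coeff m)\<bar> * (4/9) ^ (m - 1))"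
    by (rule sum_mono2) auto
  moreover have "0 \<le> 12 * (real (n + 15) + 2) * (real (n + 15) + 3) * (4/9) ^ (n + 15)"
    by simp
  moreover have "(\<Sum>m = 2..n + 15. \<bar>real_of_int (damped_coeff m)\<bar> * (4/9) ^ (m - 1))
      + 12 * (real (n + 15) + 2) * (real (n + 15) + 3) * (4/9) ^ (n + 15) \<le> 3/4"
    using sum_abs_damped_coeff_add_tail_le[of "n + 15"] by simp
  ultimately show ?thesis by linarith
qed

lemma c_seq_values: "c_seq 1 = 3" "c_seq 2 = 5" "c_seq 3 = 10" "c_seq 4 = 25" "c_seq 5 = 64"
  "c_seq 6 = 160" "c_seq 7 = 390"
proof -
  have set: "{2..4::nat} = {2,3,4}" "{2..5::nat} = {2,3,4,5}" "{2..6::nat} = {2,3,4,5,6}"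
    "{2..7::nat} = {2,3,4,5,6,7}" "{0..2::nat} = {0,1,2}" by auto
  show 1: "c_seq 1 = 3"
    using alt_sigma_values(2) by (subst c_seq.simps) (simp add: alt_sigma_def c_seq_0)
  show 2: "c_seq 2 = 5"
    using alt_sigma_values(2,3) 1 by (subst c_seq.simps) (simp add: alt_sigma_def c_seq_0 numeral_2_eq_2 numeral_3_eq_3)
  show 3: "c_seq 3 = 10"
    using alt_sigma_values(2,3,4) 1 2
    by (subst c_seq.simps) (simp add: alt_sigma_def c_seq_0 set numeral_eq_Suc)
  show 4: "c_seq 4 = 25"
    using damped_recurrence[of 4] 1 2 3 by (simp add: set damped_coeff_values c_seq_0)
  show 5: "c_seq 5 = 64"
    using damped_recurrence[of 5] 1 2 3 4 by (simp add: set damped_coeff_values c_seq_0)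
  show 6: "c_seq 6 = 160"
    using damped_recurrence[of 6] 1 2 3 4 5 by (simp add: set damped_coeff_values c_seq_0)
  show "c_seq 7 = 390"
    using damped_recurrence[of 7] 1 2 3 4 5 6 by (simp add: set damped_coeff_values c_seq_0)
qed

text \<open>The ratios \<open>c\<^sub>2 / c\<^sub>1\<close> and \<open>c\<^sub>3 / c\<^sub>2\<close> are below \<open>9/4\<close>, so this holds only from index 7 on (by a narrow margin).\<close>

definition dominates :: "nat \<Rightarrow> bool" where
  "dominates n \<longleftrightarrow> 0 < c_seq n \<and> (\<forall>k\<le>n. \<bar>real_of_int (c_seq k)\<bar> \<le> (4/9) ^ (n - k) * c_seq n)"

lemma dominates_imp_ratio:
  assumes "dominates n" "n \<ge> 3"
  shows "\<bar>real_of_int (c_seq (Suc n)) - 3 * c_seq n\<bar> \<le> 3/4 * c_seq n"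
proof -
  let ?R = "\<Sum>m = 2..Suc n. damped_coeff m * c_seq (Suc n - m)"
  have "\<bar>real_of_int ?R\<bar> \<le> (\<Sum>m = 2..Suc n. \<bar>real_of_int (damped_coeff m)\<bar> * \<bar>real_of_int (c_seq (Suc n - m))\<bar>)"
    unfolding of_int_sum of_int_mult abs_mult[symmetric] by (rule sum_abs)
  also have "\<dots> \<le> (\<Sum>m = 2..Suc n. \<bar>real_of_int (damped_coeff m)\<bar> * ((4/9) ^ (m - 1) * c_seq n))"
  proof (intro sum_mono mult_left_mono)
    fix m assume m: "m \<in> {2..Suc n}"
    \<comment> \<open>The term lies \<open>m - 1\<close> places below \<open>n\<close>, hence the
      exponent in the weighted sum.\<close>
    then have "n - (Suc n - m) = m - 1" "Suc n - m \<le> n" by auto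
    then show "\<bar>real_of_int (c_seq (Suc n - m))\<bar> \<le> (4/9) ^ (m - 1) * c_seq n"
      using assms(1) by (auto simp: dominates_def dest: spec[of _ "Suc n - m"])
  qed auto
  also have "\<dots> = (\<Sum>m = 2..Suc n. \<bar>real_of_int (damped_coeff m)\<bar> * (4/9) ^ (m - 1)) * c_seq n"
    unfolding sum_distrib_right by (simp only: mult.assoc)
  also have "\<dots> \<le> 3/4 * c_seq n"
    by (rule mult_right_mono[OF sum_abs_damped_coeff_le]) (use assms in \<open>auto simp: dominates_def\<close>)
  finally have "\<bar>real_of_int ?R\<bar> \<le> 3/4 * c_seq n" .
  moreover have "c_seq (Suc n) - 3 * c_seq n = - ?R"
    using damped_recurrence[of "Suc n"] assms(2) by simp
  then have "real_of_int (c_seq (Suc n) - 3 * c_seq n) = real_of_int (- ?R)"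
    by (simp only:)
  ultimately show ?thesis by simp
qed

lemma c_seq_dominates:
  assumes "n \<ge> 7"
  shows "dominates n"
  using assms
proof (induction n rule: dec_induct)
  case base
  have "\<bar>real_of_int (c_seq k)\<bar> \<le> (4/9) ^ (7 - k) * c_seq 7" if "k \<le> 7" for k
  proof -
    have "k \<in> {0,1,2,3,4,5,6,7}" using that by auto
    then show ?thesis by (auto simp: c_seq_0 c_seq_values[simplified] power_divide)
  qed
  then show ?case using c_seq_values(7) by (simp add: dominates_def)
next
  case (step n)
  have pos: "0 < c_seq n"
    and dom: "\<And>k. k \<le> n \<Longrightarrow> \<bar>real_of_int (c_seq k)\<bar> \<le> (4/9) ^ (n - k) * c_seq n"
    using step.IH by (auto simp: dominates_def)
  have lower: "9/4 * real_of_int (c_seq n) \<le> c_seq (Suc n)"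
    using dominates_imp_ratio[OF step.IH] step.hyps by linarith
  have "\<bar>real_of_int (c_seq k)\<bar> \<le> (4/9) ^ (Suc n - k) * c_seq (Suc n)" if "k \<le> n" for k
  proof -
    have "\<bar>real_of_int (c_seq k)\<bar> \<le> (4/9) ^ (n - k) * c_seq n" using dom that by blast
    also have "\<dots> \<le> (4/9) ^ (n - k) * (4/9 * c_seq (Suc n))"
      using lower by (intro mult_left_mono) auto
    finally show ?thesis using that by (simp add: Suc_diff_le)
  qed
  moreover have "0 < real_of_int (c_seq n)" using pos by simp
  then have "0 < real_of_int (c_seq (Suc n))" using lower by linarith
  ultimately show ?case by (auto simp: dominates_def le_Suc_eq)
qed

lemma c_seq_pos: "0 < c_seq n"
proof (cases "n \<ge> 7")
  case False
  then have "n \<in> {0,1,2,3,4,5,6}" by auto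
  then show ?thesis by (auto simp: c_seq_0 c_seq_values[simplified])
qed (use c_seq_dominates dominates_def in blast)

text \<open>From index 7 on the ratio is at most \<open>3 + 3/4 < 4\<close>; the earlier ratios are
  checked by value. Since \<open>4 * 11/50 < 1\<close>, this yields convergence at 11/50.\<close>

lemma c_seq_growth: "real_of_int (c_seq n) \<le> 4 ^ n"
proof (induction n)
  case (Suc n)
  have "real_of_int (c_seq (Suc n)) \<le> 4 * real_of_int (c_seq n)"
  proof (cases "n \<ge> 7")
    case True
    then show ?thesis
      using dominates_imp_ratio[OF c_seq_dominates[of n]] c_seq_pos[of n] True
      unfolding abs_le_iff by simp
  next
    case False
    then have "n \<in> {0,1,2,3,4,5,6}" by auto
    then show ?thesis by (auto simp: c_seq_0 c_seq_values[simplified] c_seq_values(2)[unfolded numeral_2_eq_2])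
  qed
  also have "\<dots> \<le> 4 * 4 ^ n" using Suc by (rule mult_left_mono) simp
  finally show ?case by simp
qed (simp add: c_seq_0)

section \<open>The generating functions at 11/50\<close>

text \<open>The second summand on the left is a reserve for the remaining series: each step spends
  part of it on the next term in absolute value. The constant is
  \<open>2.13895 = 9.7225 * 11/50\<close>.\<close>

lemma alt_sigma_series_lower:
  assumes "n \<ge> 15"
  shows "1 / 2.13895 + (real n + 2) * (real n + 3) * (11/50) ^ (n + 1)
    \<le> (\<Sum>m\<le>n. real_of_int (alt_sigma m) * (11/50) ^ m)"
  using assms
proof (induction n rule: dec_induct)
  case base
  have "{..15::nat} = insert 0 (insert 1 (set [2..<16]))" by (simp only: set_upt) auto
  then have set: "{..15::nat} = {0,1,2,3,4,5,6,7,8,9,10,11,12,13,14,15}"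
    by (simp only: upt_rec_numeral) simp
  show ?case
    by (simp add: set alt_sigma_values[simplified] power_divide)
next
  case (step n)
  have "\<bar>real_of_int (alt_sigma (Suc n))\<bar> \<le> (real n + 2) * (real n + 3) / 2"
    using alt_sigma_bound[of "Suc n"] by (simp add: add_ac)
  moreover have "(real n + 2) * (real n + 3) / 2 + (real n + 3) * (real n + 4) * (11/50)
      \<le> (real n + 2) * (real n + 3)"
    using zero_le_mult_iff[of "real n" "real n"] by (simp add: field_simps)
  ultimately have "(\<bar>real_of_int (alt_sigma (Suc n))\<bar> + (real n + 3) * (real n + 4) * (11/50)) * (11/50) ^ Suc n
     \<le> ((real n + 2) * (real n + 3)) * (11/50) ^ Suc n"
    by (intro mult_right_mono) auto
  then have "\<bar>real_of_int (alt_sigma (Suc n))\<bar> * (11/50) ^ Suc n + (real n + 3) * (real n + 4) * (11/50) ^ Suc (Suc n)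
     \<le> (real n + 2) * (real n + 3) * (11/50) ^ Suc n"
    by (simp only: distrib_right power_Suc[of _ "Suc n"] mult.assoc)
  moreover have "- \<bar>real_of_int (alt_sigma (Suc n))\<bar> * (11/50) ^ Suc n
      \<le> real_of_int (alt_sigma (Suc n)) * (11/50) ^ Suc n"
    by (intro mult_right_mono) auto
  moreover have "real (Suc n) + 2 = real n + 3" "real (Suc n) + 3 = real n + 4" by simp_all
  moreover have "n + 1 = Suc n" "Suc n + 1 = Suc (Suc n)" by simp_all
  ultimately show ?case using step.IH by (simp only: sum.atMost_Suc)
qed

lemma summable_alt_sigma: "summable (\<lambda>m. norm (real_of_int (alt_sigma m) * (11/50) ^ m))"
proof (rule summable_comparison_test')
  show "summable (\<lambda>m. 2 * (11/25::real) ^ m)" by (intro summable_mult summable_geometric) auto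
  fix m :: nat
  \<comment> \<open>Trading the quadratic for powers of 2 leaves a geometric series of ratio
    \<open>2 * 11/50 = 11/25\<close>.\<close>
  have "(real m + 1) * (real m + 2) \<le> 4 * 2 ^ m"
  proof (induction m)
    case (Suc m)
    show ?case
    proof (cases "m = 0")
      case False
      then have "1 \<le> real m" "1 \<le> real m * real m"
        using mult_mono[of 1 "real m" 1 "real m"] by auto
      moreover have "2 * ((real m + 1) * (real m + 2)) \<le> 2 * (4 * 2 ^ m)"
        using Suc by (rule mult_left_mono) simp
      ultimately show ?thesis by (simp add: algebra_simps)
    qed simp
  qed simp
  then have "\<bar>real_of_int (alt_sigma m)\<bar> \<le> 2 * 2 ^ m" using alt_sigma_bound[of m] by linarith
  then have "\<bar>real_of_int (alt_sigma m)\<bar> * (11/50) ^ m \<le> 2 * 2 ^ m * (11/50) ^ m"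
    by (intro mult_right_mono) auto
  also have "\<dots> = 2 * (11/25) ^ m" by (simp flip: power_mult_distrib)
  finally show "norm (norm (real_of_int (alt_sigma m) * (11/50) ^ m)) \<le> 2 * (11/25) ^ m"
    by (simp add: abs_mult)
qed

lemma summable_c_seq: "summable (\<lambda>n. norm (real_of_int (c_seq n) * (11/50) ^ n))"
proof (rule summable_comparison_test')
  show "summable (\<lambda>n. (22/25::real) ^ n)" by (intro summable_geometric) auto
  fix n :: nat
  have "real_of_int (c_seq n) * (11/50) ^ n \<le> 4 ^ n * (11/50) ^ n"
    by (intro mult_right_mono c_seq_growth) auto
  also have "\<dots> = (22/25) ^ n" by (simp flip: power_mult_distrib)
  finally show "norm (norm (real_of_int (c_seq n) * (11/50) ^ n)) \<le> (22/25) ^ n"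
    using c_seq_pos[of n] by (simp add: abs_mult)
qed

text \<open>By the Cauchy product the two series at 11/50 have product 1, so the lower bound for one
  bounds the other; positivity of \<open>c_seq\<close> passes this to partial sums.\<close>

lemma c_seq_partial_sum_le: "(\<Sum>k<n. real_of_int (c_seq k) * (11/50) ^ k) \<le> 2.13895"
proof -
  let ?a = "\<lambda>k. real_of_int (c_seq k) * (11/50) ^ k" and ?b = "\<lambda>m. real_of_int (alt_sigma m) * (11/50) ^ m"
  have "(\<Sum>i\<le>k. ?a i * ?b (k - i)) = (if k = 0 then 1 else 0)" for k
  proof -
    have "(\<Sum>i\<le>k. ?a i * ?b (k - i)) = (\<Sum>i\<le>k. real_of_int (c_seq i * alt_sigma (k - i)) * (11/50) ^ k)"
      by (intro sum.cong) (auto simp flip: power_add)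
    also have "\<dots> = real_of_int (\<Sum>i\<le>k. c_seq i * alt_sigma (k - i)) * (11/50) ^ k"
      by (simp add: sum_distrib_right)
    also have "(\<Sum>i\<le>k. c_seq i * alt_sigma (k - i)) = fps_nth (Abs_fps c_seq * Abs_fps alt_sigma) k"
      by (simp add: fps_mult_nth atLeast0AtMost)
    finally show ?thesis by (simp add: c_seq_mult_alt_sigma)
  qed
  then have "(\<lambda>k. if k = 0 then 1 else 0) sums (suminf ?a * suminf ?b)"
    using Cauchy_product_sums[OF summable_c_seq summable_alt_sigma] by simp
  then have prod: "suminf ?a * suminf ?b = 1"
    using sums_single[of 0 "\<lambda>_. 1::real"] sums_unique2 by fastforce
  have "1 / 2.13895 \<le> suminf ?b"
  proof (rule LIMSEQ_le_const)
    show "(\<lambda>n. \<Sum>m\<le>n. ?b m) \<longlonglongrightarrow> suminf ?b"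
      by (rule summable_LIMSEQ') (rule summable_norm_cancel[OF summable_alt_sigma])
    have "1 / 2.13895 \<le> (\<Sum>m\<le>n. ?b m)" if "n \<ge> 15" for n
      using alt_sigma_series_lower[OF that] by (rule order_trans[rotated]) simp
    then show "\<exists>N. \<forall>n\<ge>N. 1 / 2.13895 \<le> (\<Sum>m\<le>n. ?b m)" by blast
  qed
  moreover have le: "(\<Sum>k<n. ?a k) \<le> suminf ?a"
    by (rule sum_le_suminf[OF summable_norm_cancel[OF summable_c_seq]])
      (use c_seq_pos in \<open>auto simp: less_imp_le\<close>)
  moreover have "0 \<le> suminf ?a"
    by (rule suminf_nonneg[OF summable_norm_cancel[OF summable_c_seq]])
      (use c_seq_pos in \<open>auto simp: less_imp_le\<close>)
  ultimately have "suminf ?a * (1 / 2.13895) \<le> 1"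
    using mult_left_mono[of "1 / 2.13895" "suminf ?b" "suminf ?a"] by (simp only: prod)
  with le show ?thesis by simp
qed

section \<open>The matrices \<open>M_mat\<close>\<close>

text \<open>The infinite real matrix truncated by \<open>M_mat\<close>. Indices start at 0, so
  \<open>Suc i - j\<close> is the shifted form of \<open>i - j + 1\<close>, and column
  \<open>j\<close> carries \<open>h (Suc j)\<close>.\<close>

definition hess :: "(nat \<Rightarrow> real) \<Rightarrow> nat \<Rightarrow> nat \<Rightarrow> real" where
  "hess h i j = (if j \<le> Suc i then real_of_int (c_seq (Suc i - j)) * h (Suc j) else 0)"

lemma hess_weighted_column:
  assumes "h (Suc j) \<le> H" "0 \<le> h (Suc j)"
  shows "(\<Sum>i<m. (11/50) ^ i * hess h i j) \<le> 9.7225 * H * (11/50) ^ j"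
proof -
  let ?c = "\<lambda>k. real_of_int (c_seq k) * (11/50) ^ k"
  \<comment> \<open>The extra factor 11/50 raises the exponent to \<open>Suc i\<close>, which splits
    as \<open>(Suc i - j) + j\<close>; it is later divided out of 2.13895.\<close>
  have "(11/50) * ((11/50) ^ i * hess h i j) = (if j \<le> Suc i then ?c (Suc i - j) else 0) * (11/50) ^ j * h (Suc j)" for i
  proof (cases "j \<le> Suc i")
    case True
    then have "(11/50 :: real) ^ (Suc i - j) * (11/50) ^ j = (11/50) ^ Suc i"
      by (simp only: le_add_diff_inverse2 flip: power_add)
    with True show ?thesis by (simp add: hess_def)
  qed (simp add: hess_def)
  then have "(11/50) * (\<Sum>i<m. (11/50) ^ i * hess h i j)
      = (\<Sum>i<m. if j \<le> Suc i then ?c (Suc i - j) else 0) * (11/50) ^ j * h (Suc j)"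
    by (simp only: sum_distrib_left sum_distrib_right)
  also have "(\<Sum>i<m. if j \<le> Suc i then ?c (Suc i - j) else 0) \<le> 2.13895"
  proof -
    have "(\<Sum>i<m. if j \<le> Suc i then ?c (Suc i - j) else 0) = (\<Sum>i\<in>{i. i < m \<and> j \<le> Suc i}. ?c (Suc i - j))"
      by (subst sum.inter_filter[symmetric]) auto
    \<comment> \<open>Distinct rows give distinct indices \<open>k \<le> m\<close>, so the column is
      part of a partial sum of the series.\<close>
    also have "\<dots> = (\<Sum>k\<in>(\<lambda>i. Suc i - j) ` {i. i < m \<and> j \<le> Suc i}. ?c k)"
      by (subst sum.reindex) (auto simp: inj_on_def)
    also have "\<dots> \<le> (\<Sum>k<Suc m. ?c k)"
      by (rule sum_mono2) (use c_seq_pos in \<open>auto simp: less_imp_le\<close>)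
    also have "\<dots> \<le> 2.13895" by (rule c_seq_partial_sum_le)
    finally show ?thesis .
  qed
  then have "(\<Sum>i<m. if j \<le> Suc i then ?c (Suc i - j) else 0) * (11/50) ^ j * h (Suc j)
      \<le> 2.13895 * (11/50) ^ j * H"
    using assms by (intro mult_mono) (auto intro!: sum_nonneg simp: c_seq_pos less_imp_le)
  finally show ?thesis by (simp add: algebra_simps)
qed

theorem corollary2p6:
  fixes h :: "nat \<Rightarrow> real"
  assumes "bounded (h ` {1..})"
    and "\<And>n. n \<ge> 1 \<Longrightarrow> h n > 0"
    and "h 1 = 1"
  shows "0 < rho h 2 \<and> (\<forall>n\<ge>2. rho h n < rho h (n + 1)) \<and>
    convergent (rho h) \<and> lim (rho h) \<le> 9.7225 * (SUP m\<in>{1..}. h m)"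
proof -
  interpret pos_hessenberg "hess h"
    by unfold_locales (use assms(2) c_seq_pos in \<open>auto simp: hess_def\<close>)
  obtain f where f: "\<And>n. perron (Suc n) (f n)" "strict_mono f" "f 0 = hess h 0 0"
    using perron_chain by auto
  have f_pos: "0 < f n" for n
  proof -
    have "0 < f 0" using f(3) entry_pos[of 0 0] by simp
    also have "f 0 \<le> f n" using f(2) by (simp add: strict_mono_less_eq)
    finally show ?thesis .
  qed
  \<comment> \<open>\<open>M_mat h n\<close> has size \<open>n - 1\<close>, and \<open>f n\<close>
    is the root of order \<open>Suc n\<close>; hence the shift by 2.\<close>
  have M: "M_mat h (n + 2) = trunc (Suc n)" for n
    by (rule eq_matI) (auto simp: M_mat_def trunc_def hess_def)
  have rho: "rho h (n + 2) = f n" for n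
    unfolding rho_def M using f(1) f_pos[of n] by (intro spectral_radius_trunc) (auto simp: less_imp_le)
  define H where "H = (SUP m\<in>{1..}. h m)"
  have H: "h n \<le> H" if "n \<ge> 1" for n
    unfolding H_def using that assms(1) by (intro cSUP_upper bounded_imp_bdd_above) auto
  have f_le: "f n \<le> 9.7225 * H" for n
  proof (rule perron_le[OF f(1)])
    show "0 < (11/50 :: real) ^ i" for i by simp
    show "(\<Sum>i<Suc n. (11/50) ^ i * hess h i j) \<le> 9.7225 * H * (11/50) ^ j" for j
      using H[of "Suc j"] assms(2)[of "Suc j"] by (intro hess_weighted_column) auto
  qed simp
  obtain L where L: "f \<longlonglongrightarrow> L"
    using incseq_convergent[OF strict_mono_mono[OF f(2)]] f_le by blast
  then have "(\<lambda>n. rho h (n + 2)) \<longlonglongrightarrow> L" by (simp only: rho)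
  \<comment> \<open>The values of \<open>rho h\<close> at 0 and 1 do not affect the limit.\<close>
  then have lim: "rho h \<longlonglongrightarrow> L" by (rule LIMSEQ_offset)
  have "L \<le> 9.7225 * H" using L f_le by (intro LIMSEQ_le_const2) auto
  moreover have "rho h n < rho h (n + 1)" if "n \<ge> 2" for n
  proof -
    define k where "k = n - 2"
    have k: "n = k + 2" using that by (simp add: k_def)
    have "f k < f (Suc k)" using f(2) by (simp add: strict_mono_Suc_iff)
    then show ?thesis using rho[of k] rho[of "Suc k"] by (simp add: k)
  qed
  moreover have "0 < rho h 2" using rho[of 0] f_pos[of 0] by (simp add: numeral_2_eq_2)
  ultimately show ?thesis
    using lim limI[OF lim] by (auto simp: convergent_def H_def)
qed

end
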